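(* Let $K\subset\mathbb{R}^d$ be a non-empty compact set and let $X,Y$ be random closed sets in $\mathbb{R}^d$ such that $0\in G:=Y\ominus\check X\subseteq K$. For each window $W$ let $$\widehat G^2_W=\left(\left[Y_W\cup\overline{(X_W+K)\setminus W}\right]\ominus\check X_W\right)\cap K .$$ Then $\widehat G^2_W$ is consistent, i.e. $\widehat G^2_W\downarrow G$ whenever $W\uparrow\mathbb{R}^d$.
   Context: For $A,D\subseteq\mathbb{R}^d$: $A^C$ is the complement of $A$, $\overline{A}$ its closure, $A+D=\{a+d:a\in A,d\in D\}$ (with $\emptyset+A=\emptyset$), $\check A=\{-a:a\in A\}$, $A\ominus D=(A^C+D)^C=\bigcap_{d\in D}(d+A)$. In particular $Y\ominus\check X=\{g: g+X\subseteq Y\}$. For a set $A$ and window $W$, $A_W=A\cap W$, and $\check X_W$ is the reflection of $X\cap W$. A random closed set is a map $X$ from a probability space to the closed subsets of $\mathbb{R}^d$ such that $\{X\cap L\ne\emptyset\}$ is measurable for each compact $L$. $W\uparrow\mathbb{R}^d$ means that $W$ runs along a convex averaging sequence $(W_i)_{i\in\mathbb{N}}$ of non-empty sets: each $W_i$ is compact and convex, $W_i\subset W_{i+1}$, and $\sup\{r\ge0: B(x,r)\subset W_i\text{ for some }x\in W_i\}\uparrow\infty$, where $B(x,r)$ is the ball of centre $x$ and radius $r$. The notation $\widehat G^2_W\downarrow G$ means that $\widehat G^2_{W_i}$ decreases, with respect to set inclusion, to $G$, i.e. $\widehat G^2_{W_{i+1}}\subseteq\widehat G^2_{W_i}$ for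 all $i$ and $\bigcap_i\widehat G^2_{W_i}=G$.
   Formalization: As stated the claim is false; the formal version also requires that the windows W_i have union R^d, and asserts that the estimators decrease only when each W_i lies in the interior of W_{i+1}; the intersection equals G for all such sequences with union R^d. *)

theory Defs
  imports "HOL-Probability.Probability"
begin

text \<open>
  On sets, \<open>A + D\<close> is the Minkowski sum of \<open>HOL-Library.Set_Algebras\<close>, whereas \<open>- A\<close> is the
  set complement; the reflection therefore gets its own name.
\<close>

definition reflect :: "'a::ab_group_add set \<Rightarrow> 'a set"
  where "reflect A = uminus ` A"

definition mink_diff :: "'a::ab_group_add set \<Rightarrow> 'a set \<Rightarrow> 'a set"  (infixl "\<ominus>\<^sub>M" 65)
  where "A \<ominus>\<^sub>M D = - ((- A) + D)"

definition random_closed_set :: "'w measure \<Rightarrow> ('w \<Rightarrow> 'a::euclidean_space set) \<Rightarrow> bool"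
  where "random_closed_set M X \<longleftrightarrow>
    (\<forall>\<omega>\<in>space M. closed (X \<omega>)) \<and>
    (\<forall>L. compact L \<longrightarrow> {\<omega> \<in> space M. X \<omega> \<inter> L \<noteq> {}} \<in> sets M)"

text \<open>
  The inradii are automatically nondecreasing because the windows are nested, so only their
  divergence is stated. The supremum is over a bounded set containing 0.
\<close>

definition convex_averaging_sequence :: "(nat \<Rightarrow> 'a::euclidean_space set) \<Rightarrow> bool"
  where "convex_averaging_sequence W \<longleftrightarrow>
    (\<forall>i. W i \<noteq> {} \<and> compact (W i) \<and> convex (W i) \<and> W i \<subseteq> W (Suc i)) \<and>
    filterlim (\<lambda>i. Sup {r::real. 0 \<le> r \<and> (\<exists>x\<in>W i. cball x r \<subseteq> W i)}) at_top sequentially"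

text \<open>
  Diverging inradii alone do not force the windows to fill the space: the intervals \<open>{0..i}\<close> on
  the real line only fill a half-line, and windows that miss part of the space cannot detect the
  constraints imposed there. That \<open>W\<close> increases to the whole space is therefore required
  separately.
\<close>

definition windows_to_space :: "(nat \<Rightarrow> 'a::euclidean_space set) \<Rightarrow> bool"
  where "windows_to_space W \<longleftrightarrow> convex_averaging_sequence W \<and> (\<Union>i. W i) = UNIV"

definition set_decreases_to :: "(nat \<Rightarrow> 'a set) \<Rightarrow> 'a set \<Rightarrow> bool"
  where "set_decreases_to A G \<longleftrightarrow> (\<forall>i. A (Suc i) \<subseteq> A i) \<and> (\<Inter>i. A i) = G"

text \<open>
  Pitfall: \<open>Ghat2 K X Y\<close> is not antitone in the window for merely nested windows. On the real
  line take \<open>X = Y = {1, 2}\<close> and \<open>K = {0, -1} \<union> {-3..-2}\<close>, so that \<open>Y \<ominus>\<^sub>M reflect X = {0}\<close>. Then \<open>-1\<close>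
  belongs to \<open>Ghat2 K X Y {0..2}\<close> but not to \<open>Ghat2 K X Y {0..1}\<close>: the two windows share the
  boundary point 0, which is a limit of points of \<open>(X \<inter> {0..2} + K) - {0..2}\<close> but not of
  \<open>(X \<inter> {0..1} + K) - {0..1}\<close>. Nesting in the interior, \<open>W \<subseteq> interior W'\<close>, excludes this.
\<close>

definition Ghat2 :: "'a::euclidean_space set \<Rightarrow> 'a set \<Rightarrow> 'a set \<Rightarrow> 'a set \<Rightarrow> 'a set"
  where "Ghat2 K X Y W =
    (((Y \<inter> W) \<union> closure (((X \<inter> W) + K) - W)) \<ominus>\<^sub>M reflect (X \<inter> W)) \<inter> K"

end

theory Submission
  imports Defs
begin

text \<open>
  A point \<open>g + x\<close> with \<open>x \<in> X \<inter> W\<close> and \<open>g \<in> K\<close> that leaves \<open>W\<close> automatically lies in the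
  edge-correction set \<open>(X \<inter> W + K) - W\<close>, so only points \<open>g + x \<in> W\<close> impose a constraint; this gives
  \<open>G \<subseteq> Ghat2\<close>. Conversely the closure of the edge-correction set misses the interior of \<open>W\<close>, so
  a point \<open>g + x\<close> interior to \<open>W\<close> can only be allowed by lying in \<open>Y\<close>. Since convex windows
  exhausting the space contain every point in the interior of some window, all constraints defining
  \<open>G\<close> are eventually seen.
\<close>

text \<open>Solving \<open>g = a + (- d)\<close> with \<open>a\<close> outside \<open>A\<close>
  gives \<open>a = g + d\<close>, so the complement excludes exactly those \<open>g\<close> that
  push some \<open>d\<close> out of \<open>A\<close>.\<close>

lemma mem_mink_diff_reflect: "g \<in> A \<ominus>\<^sub>M reflect D \<longleftrightarrow> (\<forall>d\<in>D. g + d \<in> A)"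
proof -
  have "g \<in> - A + reflect D \<longleftrightarrow> (\<exists>d\<in>D. g + d \<notin> A)"
  proof
    assume "g \<in> - A + reflect D"
    then show "\<exists>d\<in>D. g + d \<notin> A"
      by (force simp: reflect_def elim!: set_plus_elim)
  next
    assume "\<exists>d\<in>D. g + d \<notin> A"
    then obtain d where "d \<in> D" "g + d \<notin> A" by blast
    then have "(g + d) + - d \<in> - A + reflect D"
      unfolding reflect_def by (intro set_plus_intro) auto
    then show "g \<in> - A + reflect D" by simp
  qed
  then show ?thesis
    by (auto simp: mink_diff_def)
qed

lemma mem_Ghat2:
  "g \<in> Ghat2 K X Y W \<longleftrightarrow>
    g \<in> K \<and> (\<forall>x\<in>X \<inter> W. g + x \<in> Y \<inter> W \<or> g + x \<in> closure ((X \<inter> W + K) - W))"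
  unfolding Ghat2_def by (auto simp: mem_mink_diff_reflect)

lemma edge_correctionI:
  fixes g :: "'a::euclidean_space"
  assumes "g \<in> K" "x \<in> X \<inter> W" "g + x \<notin> W"
  shows "g + x \<in> closure ((X \<inter> W + K) - W)"
proof -
  have "x + g \<in> X \<inter> W + K"
    using assms by (intro set_plus_intro)
  then have "g + x \<in> (X \<inter> W + K) - W"
    using assms(3) by (simp add: add.commute[of g x])
  then show ?thesis
    using closure_subset by (rule subsetD[rotated])
qed

text \<open>The closure of \<open>- W\<close> is the complement of \<open>interior W\<close>, so
  closing the edge correction adds at most frontier points of \<open>W\<close>.\<close>

lemma edge_correction_notin_interior:
  "p \<in> closure (Z - W) \<Longrightarrow> p \<notin> interior W"
  using closure_mono[of "Z - W" "- W"] by (auto simp: closure_complement)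

lemma mink_diff_subset_Ghat2:
  assumes "Y \<ominus>\<^sub>M reflect X \<subseteq> K"
  shows "Y \<ominus>\<^sub>M reflect X \<subseteq> Ghat2 K X Y W"
proof
  fix g assume g: "g \<in> Y \<ominus>\<^sub>M reflect X"
  \<comment> \<open>Needed twice: for the final intersection with \<open>K\<close>, and to put
    \<open>g + x\<close> into the edge correction when it leaves \<open>W\<close>.\<close>
  then have "g \<in> K" using assms by blast
  then show "g \<in> Ghat2 K X Y W"
    using g edge_correctionI[of g K _ X W] unfolding mem_Ghat2 mem_mink_diff_reflect by blast
qed

text \<open>If \<open>x\<close> and \<open>g + x\<close> both lie in \<open>W\<close>, then
  \<open>g + x\<close> is interior to \<open>W'\<close>, out of reach of the edge correction of
  \<open>W'\<close>, which forces it into \<open>Y\<close>.\<close>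

lemma Ghat2_antimono_interior:
  assumes "W \<subseteq> interior W'"
  shows "Ghat2 K X Y W' \<subseteq> Ghat2 K X Y W"
proof
  fix g assume g: "g \<in> Ghat2 K X Y W'"
  have gK: "g \<in> K" using g by (simp add: mem_Ghat2)
  have "g + x \<in> Y \<inter> W" if x: "x \<in> X \<inter> W" and gx: "g + x \<in> W" for x
  proof -
    have "x \<in> X \<inter> W'" using x assms interior_subset by blast
    then have "g + x \<in> Y \<or> g + x \<in> closure ((X \<inter> W' + K) - W')"
      using g unfolding mem_Ghat2 by blast
    moreover have "g + x \<in> interior W'"
      using gx assms by (rule subsetD[rotated])
    ultimately show ?thesis
      using gx edge_correction_notin_interior[of "g + x" _ W'] by blast
  qed
  then show "g \<in> Ghat2 K X Y W"
    using gK edge_correctionI[of g K _ X W] unfolding mem_Ghat2 by blast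
qed

lemma incseq_finite_subset_UN:
  assumes "incseq A" "finite S" "S \<subseteq> (\<Union>i. A i)"
  shows "\<exists>i::nat. S \<subseteq> A i"
  using assms(2,3)
proof (induction S)
  case (insert s S)
  then obtain i j where "S \<subseteq> A i" "s \<in> A j" by auto
  then have "insert s S \<subseteq> A (max i j)"
    using incseqD[OF assms(1), of i "max i j"] incseqD[OF assms(1), of j "max i j"] by auto
  then show ?case ..
qed simp

text \<open>Convexity reduces a whole neighbourhood to finitely many points: a window containing all
  vertices of a cube around \<open>p\<close> contains the cube.\<close>

lemma convex_incseq_UN_UNIV_interior:
  fixes W :: "nat \<Rightarrow> 'a::euclidean_space set"
  assumes "incseq W" "\<And>i. convex (W i)" "(\<Union>i. W i) = UNIV"
  shows "\<exists>i. p \<in> interior (W i)"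
proof -
  \<comment> \<open>The half side 1 is arbitrary; any positive value leaves \<open>p\<close>
    interior to the cube.\<close>
  obtain S where S: "finite S" "cbox (p - (\<Sum>b\<in>Basis. 1 *\<^sub>R b)) (p + (\<Sum>b\<in>Basis. 1 *\<^sub>R b)) = convex hull S"
    using cube_convex_hull[of 1 p] by auto
  obtain i where "S \<subseteq> W i"
    using incseq_finite_subset_UN[OF assms(1) S(1)] assms(3) by (metis subset_UNIV)
  then have "convex hull S \<subseteq> W i"
    by (simp add: assms(2) hull_minimal)
  moreover have "p \<in> interior (convex hull S)"
    unfolding S(2)[symmetric] interior_cbox by (simp add: mem_box inner_simps)
  ultimately show ?thesis
    using interior_mono by blast
qed

lemma INT_Ghat2_subset:
  assumes "windows_to_space W"
  shows "(\<Inter>i. Ghat2 K X Y (W i)) \<subseteq> Y \<ominus>\<^sub>M reflect X"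
proof
  fix g assume g: "g \<in> (\<Inter>i. Ghat2 K X Y (W i))"
  have W: "incseq W" "\<And>i. convex (W i)" "(\<Union>i. W i) = UNIV"
    using assms
    by (auto simp: windows_to_space_def convex_averaging_sequence_def incseq_Suc_iff)
  have "g + x \<in> Y" if "x \<in> X" for x
  proof -
    obtain i where i: "g + x \<in> interior (W i)"
      using convex_incseq_UN_UNIV_interior[OF W] by blast
    obtain j where j: "x \<in> W j" using W(3) by blast
    \<comment> \<open>A single window must contain \<open>x\<close>, so that the constraint is
      imposed, and have \<open>g + x\<close> in its interior, so that the edge correction cannot
      satisfy it.\<close>
    have "g + x \<in> interior (W (max i j))"
      using i interior_mono[OF incseqD[OF W(1), of i "max i j"]] by auto
    moreover have "x \<in> X \<inter> W (max i j)"
      using \<open>x \<in> X\<close> j incseqD[OF W(1), of j "max i j"] by auto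
    moreover have "g \<in> Ghat2 K X Y (W (max i j))" using g by (rule INT_D) simp
    ultimately show ?thesis
      using edge_correction_notin_interior[of "g + x" _ "W (max i j)"] unfolding mem_Ghat2 by blast
  qed
  then show "g \<in> Y \<ominus>\<^sub>M reflect X"
    by (simp add: mem_mink_diff_reflect)
qed

theorem corollary1p10:
  fixes M :: "'w measure"
    and X Y :: "'w \<Rightarrow> 'a::euclidean_space set"
    and K :: "'a set"
  assumes "prob_space M"
    and "random_closed_set M X"
    and "random_closed_set M Y"
    and "compact K" and "K \<noteq> {}"
  shows "\<forall>\<omega>\<in>space M. \<forall>G. G = Y \<omega> \<ominus>\<^sub>M reflect (X \<omega>) \<and> 0 \<in> G \<and> G \<subseteq> K \<longrightarrow>
    (\<forall>W. windows_to_space W \<longrightarrow>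
      (\<Inter>i. Ghat2 K (X \<omega>) (Y \<omega>) (W i)) = G \<and>
      ((\<forall>i. W i \<subseteq> interior (W (Suc i))) \<longrightarrow>
        set_decreases_to (\<lambda>i. Ghat2 K (X \<omega>) (Y \<omega>) (W i)) G))"
proof (intro ballI allI impI)
  fix \<omega> G and W :: "nat \<Rightarrow> 'a set"
  assume G: "G = Y \<omega> \<ominus>\<^sub>M reflect (X \<omega>) \<and> 0 \<in> G \<and> G \<subseteq> K" and W: "windows_to_space W"
  have "(\<Inter>i. Ghat2 K (X \<omega>) (Y \<omega>) (W i)) = G"
    using INT_Ghat2_subset[OF W, of K "X \<omega>" "Y \<omega>"] mink_diff_subset_Ghat2[of "Y \<omega>" "X \<omega>" K] G
    by blast
  then show "(\<Inter>i. Ghat2 K (X \<omega>) (Y \<omega>) (W i)) = G \<and>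
      ((\<forall>i. W i \<subseteq> interior (W (Suc i))) \<longrightarrow>
        set_decreases_to (\<lambda>i. Ghat2 K (X \<omega>) (Y \<omega>) (W i)) G)"
    using Ghat2_antimono_interior unfolding set_decreases_to_def by blast
qed

end
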